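(* There exists an ideal $3$-wise intersecting binary clutter.
   Context: Let $V$ be a finite set of elements. A family $\mathcal{C}$ of subsets of $V$ (called members) is a clutter over ground set $V$ if no member contains another one. $\mathcal{C}$ is ideal if for every $w\in\mathbb{Z}^V_+$ the linear program $\min\{w^\top x : \sum_{u\in C}x_u\ge 1\ \forall C\in\mathcal{C},\ x\ge \mathbf{0}\}$ has an integral optimal solution. $\mathcal{C}$ is $k$-wise intersecting if every subset of at most $k$ members have a common element (in $V$), yet no element of $V$ belongs to all members. $\mathcal{C}$ is binary if the symmetric difference of any odd number of members contains a member. *)

theory Defs
  imports Complex_Main
begin

definition clutter :: "'a set \<Rightarrow> 'a set set \<Rightarrow> bool" where
  "clutter V C \<longleftrightarrow> finite V \<and> C \<subseteq> Pow V \<and> (\<forall>A\<in>C. \<forall>B\<in>C. A \<subseteq> B \<longrightarrow> A = B)"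

(* A point of R^V is a total function of which only the values on V are relevant. *)
definition covering_polyhedron :: "'a set \<Rightarrow> 'a set set \<Rightarrow> ('a \<Rightarrow> real) set" where
  "covering_polyhedron V C = {x. (\<forall>A\<in>C. (\<Sum>u\<in>A. x u) \<ge> 1) \<and> (\<forall>u\<in>V. x u \<ge> 0)}"

definition ideal_clutter :: "'a set \<Rightarrow> 'a set set \<Rightarrow> bool" where
  "ideal_clutter V C \<longleftrightarrow>
     (\<forall>w :: 'a \<Rightarrow> int. (\<forall>u\<in>V. w u \<ge> 0) \<longrightarrow>
        (\<exists>x. is_arg_min (\<lambda>x. \<Sum>u\<in>V. of_int (w u) * x u) (\<lambda>x. x \<in> covering_polyhedron V C) x \<and>
             (\<forall>u\<in>V. x u \<in> \<int>)))"

(* The finiteness guard makes card meaningful; it is automatic when C is a clutter.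
   The empty subfamily is included, so V must be nonempty. *)
definition k_wise_intersecting :: "nat \<Rightarrow> 'a set \<Rightarrow> 'a set set \<Rightarrow> bool" where
  "k_wise_intersecting k V C \<longleftrightarrow>
     (\<forall>S. S \<subseteq> C \<and> finite S \<and> card S \<le> k \<longrightarrow> (\<exists>v\<in>V. \<forall>A\<in>S. v \<in> A)) \<and>
     \<not> (\<exists>v\<in>V. \<forall>A\<in>C. v \<in> A)"

definition symm_diff_list :: "'a set list \<Rightarrow> 'a set" where
  "symm_diff_list As = foldr sym_diff As {}"

(* Repeated members are allowed in the list; they cancel in pairs, preserving the
   parity of the length, so this agrees with quantifying over distinct members. *)
definition binary_clutter :: "'a set set \<Rightarrow> bool" where
  "binary_clutter C \<longleftrightarrow>
     (\<forall>As. set As \<subseteq> C \<and> odd (length As) \<longrightarrow> (\<exists>B\<in>C. B \<subseteq> symm_diff_list As))"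

lemma mem_symm_diff_list_iff:
  "v \<in> symm_diff_list As \<longleftrightarrow> odd (length (filter (\<lambda>A. v \<in> A) As))"
  by (induction As) (auto simp: symm_diff_list_def)

end

theory Submission
  imports Defs "HOL-Analysis.Function_Topology"
begin

text \<open>
  The example is the clutter of \<open>T\<close>-joins of a subdivided Petersen graph. Split every edge of the
  Petersen graph into two halves by a new vertex, and let \<open>T\<close> consist of all vertices but one. The
  new vertices have degree 2 and lie in \<open>T\<close>, so a \<open>T\<close>-join contains exactly one half of every edge;
  hence no \<open>T\<close>-join contains another. Over the two-element field the \<open>T\<close>-joins form an affine space,
  so the clutter is binary.

  Two \<open>T\<close>-joins choose different halves exactly along the edges of a cycle (an even-degree edge set)
  of the Petersen graph. Three \<open>T\<close>-joins \<open>A\<close>, \<open>B\<close>, \<open>C\<close> therefore have no common element exactly when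
  the cycles from \<open>A\<close> to \<open>B\<close> and from \<open>A\<close> to \<open>C\<close> cover all edges. Two cycles that cover a cubic graph
  yield a 3-edge-colouring, which the Petersen graph does not have. Three cycles do cover it, which
  gives four \<open>T\<close>-joins without a common element.

  Idealness holds for the \<open>T\<close>-joins of every graph with \<open>T\<close> nonempty (a theorem of Edmonds and
  Johnson, \<open>ideal_clutter_joins\<close>). The proof needs no linear programming duality. Take an optimal
  point \<open>x\<close> of the covering problem, and suppose that some cover \<open>B\<close> inside the support of \<open>x\<close> meets
  every tight member exactly once. Moving \<open>x\<close> away from the indicator of \<open>B\<close> and rescaling keeps it
  feasible, and optimality of \<open>x\<close> then says that \<open>B\<close> is no more expensive than \<open>x\<close>
  (\<open>ideal_clutter_if_tight_cover\<close>). For \<open>T\<close>-joins such a \<open>B\<close> is a suitable \<open>T\<close>-cut (\<open>tight_T_cut\<close>);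
  it is found by an idea from Sebo's proof of Seymour's theorem on \<open>T\<close>-joins: among all vertices
  \<open>v\<close>, move one point of \<open>T\<close> to the \<open>v\<close> for which the shortest join becomes shortest.
\<close>

section \<open>A primal criterion for idealness\<close>

text \<open>
  The hypothesis provides, at every feasible point, the direction in which optimality is tested.
  An optimal point exists by compactness: truncating a feasible point at 1 keeps it feasible and
  does not raise its cost. If \<open>x\<close> is optimal and \<open>B\<close> is the cover for \<open>x\<close>, then
  \<open>(x - \<epsilon> \<chi>\<^sub>B) / (1 - \<epsilon>)\<close> is feasible for small \<open>\<epsilon>\<close>, and comparing costs gives \<open>cost \<chi>\<^sub>B \<le> cost x\<close>.
  So a cheapest cover is an integral optimum.
\<close>

lemma ideal_clutter_if_tight_cover:
  fixes V :: "'a set" and C :: "'a set set"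
  assumes fin: "finite V" and CV: "C \<subseteq> Pow V" and ne: "{} \<notin> C"
    and tight: "\<And>x. x \<in> covering_polyhedron V C \<Longrightarrow>
      \<exists>B\<subseteq>V. (\<forall>u\<in>B. x u > 0) \<and> (\<forall>A\<in>C. A \<inter> B \<noteq> {}) \<and>
            (\<forall>A\<in>C. sum x A = 1 \<longrightarrow> card (A \<inter> B) = 1)"
  shows "ideal_clutter V C"
  unfolding ideal_clutter_def
proof (intro allI impI)
  fix w :: "'a \<Rightarrow> int" assume w: "\<forall>u\<in>V. w u \<ge> 0"
  define cost where "cost x = (\<Sum>u\<in>V. of_int (w u) * x u)" for x :: "'a \<Rightarrow> real"
  define covers where "covers = {B. B \<subseteq> V \<and> (\<forall>A\<in>C. A \<inter> B \<noteq> {})}"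
  have finC: "finite C" and finA: "\<And>A. A \<in> C \<Longrightarrow> finite A"
    using fin CV by (auto intro: finite_subset)
  have "finite covers" "V \<in> covers"
    using fin CV ne by (auto simp: covers_def Int_absorb2 in_mono)
  then obtain B0 where B0: "B0 \<in> covers"
      and B0_min: "\<And>B. B \<in> covers \<Longrightarrow> cost (indicator B0) \<le> cost (indicator B)"
    using ex_min_if_finite[of "(\<lambda>B. cost (indicator B)) ` covers"] 
    by (metis (mono_tags, lifting) arg_min_if_finite(1) arg_min_least empty_iff)
  have sum_indicator: "(\<Sum>u\<in>A. indicator B u :: real) = card (A \<inter> B)" if "finite A" for A B :: "'a set"
    using sum.inter_restrict[OF that, of "\<lambda>_. 1 :: real" B] by (simp add: indicator_def of_bool_def)
  have B0V: "B0 \<subseteq> V" and B0A: "\<And>A. A \<in> C \<Longrightarrow> A \<inter> B0 \<noteq> {}"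
    using B0 by (auto simp: covers_def)
  have B0_poly: "indicator B0 \<in> covering_polyhedron V C"
  proof -
    have "1 \<le> (\<Sum>u\<in>A. indicator B0 u :: real)" if "A \<in> C" for A
    proof -
      have "card (A \<inter> B0) > 0"
        using B0A[OF that] finA[OF that] by (simp add: card_gt_0_iff)
      then show ?thesis
        using sum_indicator[OF finA[OF that]] by simp
    qed
    then show ?thesis by (simp add: covering_polyhedron_def)
  qed
  \<comment> \<open>Points are total functions; coordinates outside \<open>V\<close> are pinned to 0 so that the box is compact.\<close>
  define K where "K = PiE UNIV (\<lambda>u. if u \<in> V then {0..1::real} else {0})"
  define L where "L = K \<inter> covering_polyhedron V C"
  have "compact K"
  proof -
    have "compactin (product_topology (\<lambda>_. euclidean) UNIV) K"
      unfolding K_def compactin_PiE by simp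
    then show ?thesis by (simp add: euclidean_product_topology)
  qed
  moreover have "closed (covering_polyhedron V C)"
  proof -
    have "closed {x :: 'a \<Rightarrow> real. 1 \<le> (\<Sum>u\<in>A. x u)}" for A
      by (intro closed_Collect_le continuous_intros continuous_on_product_coordinates)
    moreover have "closed {x :: 'a \<Rightarrow> real. 0 \<le> x u}" for u
      by (intro closed_Collect_le continuous_intros continuous_on_product_coordinates)
    moreover have "covering_polyhedron V C =
        (\<Inter>A\<in>C. {x. 1 \<le> (\<Sum>u\<in>A. x u)}) \<inter> (\<Inter>u\<in>V. {x. 0 \<le> x u})"
      by (auto simp: covering_polyhedron_def)
    ultimately show ?thesis by (simp add: closed_INT closed_Int)
  qed
  ultimately have "compact L"
    unfolding L_def by (rule compact_Int_closed)
  moreover have "indicator B0 \<in> L"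
    using B0_poly B0V by (auto simp: L_def K_def indicator_def)
  moreover have "continuous_on L cost"
    unfolding cost_def
    by (intro continuous_intros) (rule continuous_on_subset[OF continuous_on_product_coordinates], simp)
  ultimately obtain x where x: "x \<in> L" and x_min: "\<And>y. y \<in> L \<Longrightarrow> cost x \<le> cost y"
    using continuous_attains_inf[of L cost] by blast
  have x_min': "cost x \<le> cost y" if y: "y \<in> covering_polyhedron V C" for y
  proof -
    define z where "z u = (if u \<in> V then min (y u) 1 else 0)" for u
    have "1 \<le> sum z A" if A: "A \<in> C" for A
    proof (cases "\<exists>a\<in>A. y a \<ge> 1")
      case True
      then obtain a where a: "a \<in> A" "y a \<ge> 1" by auto
      have "1 = z a" using a A CV by (auto simp: z_def)
      also have "z a \<le> sum z A"
        using a A y CV finA by (intro member_le_sum) (auto simp: z_def covering_polyhedron_def)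
      finally show ?thesis .
    next
      case False
      then have "sum z A = sum y A"
        using A CV by (intro sum.cong) (auto simp: z_def)
      then show ?thesis using y A by (simp add: covering_polyhedron_def)
    qed
    then have "z \<in> L"
      using y by (auto simp: L_def K_def covering_polyhedron_def z_def)
    then have "cost x \<le> cost z" by (rule x_min)
    also have "cost z \<le> cost y"
      unfolding cost_def using w by (intro sum_mono mult_left_mono) (auto simp: z_def)
    finally show ?thesis .
  qed
  have xp: "x \<in> covering_polyhedron V C" using x by (simp add: L_def)
  then obtain B where BV: "B \<subseteq> V" and B_pos: "\<And>u. u \<in> B \<Longrightarrow> x u > 0"
      and B_cov: "\<And>A. A \<in> C \<Longrightarrow> A \<inter> B \<noteq> {}"
      and B_tight: "\<And>A. A \<in> C \<Longrightarrow> sum x A = 1 \<Longrightarrow> card (A \<inter> B) = 1"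
    using tight[OF xp] by metis
  have finB: "finite B" using BV fin by (rule finite_subset)
  \<comment> \<open>The step is limited by nonnegativity on \<open>B\<close> and by the slack of the members that are not tight.\<close>
  obtain \<epsilon> :: real where eps: "0 < \<epsilon>" "\<epsilon> < 1" "\<And>u. u \<in> B \<Longrightarrow> \<epsilon> \<le> x u"
      and eps_slack: "\<And>A. A \<in> C \<Longrightarrow> sum x A \<noteq> 1 \<Longrightarrow> \<epsilon> * card (A \<inter> B) \<le> sum x A - 1"
  proof -
    define S where "S = insert (1/2) (x ` B \<union> (\<lambda>A. (sum x A - 1) / card (A \<inter> B)) ` {A \<in> C. sum x A \<noteq> 1})"
    have card_pos: "0 < card (A \<inter> B)" if "A \<in> C" for A
      using B_cov[OF that] finA[OF that] by (simp add: card_gt_0_iff)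
    have S: "finite S" "S \<noteq> {}" using finB finC by (auto simp: S_def)
    have "0 < s" if "s \<in> S" for s
      using that B_pos card_pos xp
      by (force simp: S_def covering_polyhedron_def intro!: divide_pos_pos)
    then have "0 < Min S" using S by simp
    moreover have "Min S < 1"
      using Min_le[OF S(1), of "1/2"] by (simp add: S_def)
    moreover have "Min S \<le> x u" if "u \<in> B" for u
      using S(1) that by (intro Min_le) (auto simp: S_def)
    moreover have "Min S * card (A \<inter> B) \<le> sum x A - 1" if "A \<in> C" "sum x A \<noteq> 1" for A
    proof -
      have "Min S \<le> (sum x A - 1) / card (A \<inter> B)"
        using S(1) that by (intro Min_le) (auto simp: S_def)
      then show ?thesis using card_pos[OF that(1)] by (simp add: pos_le_divide_eq)
    qed
    ultimately show ?thesis using that by blast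
  qed
  define y where "y u = (x u - \<epsilon> * indicator B u) / (1 - \<epsilon>)" for u
  have sum_y: "sum y A = (sum x A - \<epsilon> * card (A \<inter> B)) / (1 - \<epsilon>)" if "A \<in> C" for A
    using finA[OF that] unfolding y_def
    by (simp add: sum_divide_distrib[symmetric] sum_subtractf sum_distrib_left[symmetric] sum_indicator)
  \<comment> \<open>A tight member meets \<open>B\<close> once, so it loses exactly \<open>\<epsilon>\<close>, which the rescaling restores.\<close>
  have "1 \<le> sum y A" if A: "A \<in> C" for A
  proof -
    have "1 - \<epsilon> \<le> sum x A - \<epsilon> * card (A \<inter> B)"
    proof (cases "sum x A = 1")
      case True then show ?thesis using B_tight[OF A] by simp
    next
      case False then show ?thesis using eps_slack[OF A] eps by simp
    qed
    then show ?thesis using eps by (simp add: sum_y[OF A])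
  qed
  moreover have "0 \<le> y u" if "u \<in> V" for u
    using that eps xp by (auto simp: y_def covering_polyhedron_def indicator_def)
  ultimately have "cost x \<le> cost y"
    by (intro x_min') (simp add: covering_polyhedron_def)
  also have "cost y = (cost x - \<epsilon> * cost (indicator B)) / (1 - \<epsilon>)"
    unfolding cost_def y_def sum_distrib_left sum_subtractf[symmetric] sum_divide_distrib
    by (intro sum.cong) (auto simp: algebra_simps)
  finally have "\<epsilon> * cost (indicator B) \<le> \<epsilon> * cost x"
    using eps by (simp add: pos_le_divide_eq algebra_simps)
  then have "cost (indicator B) \<le> cost x"
    using eps by simp
  moreover have "cost (indicator B0) \<le> cost (indicator B)"
    using BV B_cov by (intro B0_min) (auto simp: covers_def)
  ultimately have "cost (indicator B0) \<le> cost z" if "z \<in> covering_polyhedron V C" for z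
    using x_min'[OF that] by linarith
  then have "is_arg_min cost (\<lambda>x. x \<in> covering_polyhedron V C) (indicator B0)"
    using B0_poly by (auto simp: is_arg_min_linorder)
  moreover have "\<forall>u\<in>V. (indicator B0 u :: real) \<in> \<int>"
    by (simp add: indicator_def)
  ultimately show "\<exists>x. is_arg_min (\<lambda>x. \<Sum>u\<in>V. of_int (w u) * x u) (\<lambda>x. x \<in> covering_polyhedron V C) x \<and>
      (\<forall>u\<in>V. x u \<in> \<int>)"
    unfolding cost_def by blast
qed

section \<open>Boundaries of edge sets over the two-element field\<close>

text \<open>
  A multigraph is given by two functions that send an edge to its ends. The inequality of the two conditions makes a loop contribute nothing, so the boundary
  is linear without any assumption on the graph.
\<close>

definition boundary :: "('e \<Rightarrow> 'v) \<Rightarrow> ('e \<Rightarrow> 'v) \<Rightarrow> 'e set \<Rightarrow> 'v set" where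
  "boundary h k P = {v. odd (card {e \<in> P. (h e = v) \<noteq> (k e = v)})}"

definition joins :: "('e \<Rightarrow> 'v) \<Rightarrow> ('e \<Rightarrow> 'v) \<Rightarrow> 'e set \<Rightarrow> 'v set \<Rightarrow> 'e set set" where
  "joins h k E T = {J. J \<subseteq> E \<and> boundary h k J = T}"

definition edge_cut :: "('e \<Rightarrow> 'v) \<Rightarrow> ('e \<Rightarrow> 'v) \<Rightarrow> 'e set \<Rightarrow> 'v set \<Rightarrow> 'e set" where
  "edge_cut h k E U = {e \<in> E. (h e \<in> U) \<noteq> (k e \<in> U)}"

lemma odd_card_sym_diff:
  assumes "finite A" "finite B"
  shows "odd (card (sym_diff A B)) \<longleftrightarrow> odd (card A) \<noteq> odd (card B)"
proof -
  have "card A = card (A \<inter> B) + card (A - B)" "card B = card (A \<inter> B) + card (B - A)"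
    using assms card_Int_Diff[of A B] card_Int_Diff[of B A] by (simp_all add: Int_commute)
  moreover have "card (sym_diff A B) = card (A - B) + card (B - A)"
    using assms by (intro card_Un_disjoint) auto
  ultimately show ?thesis by auto
qed

lemma boundary_sym_diff:
  assumes "finite P" "finite Q"
  shows "boundary h k (sym_diff P Q) = sym_diff (boundary h k P) (boundary h k Q)"
proof (rule set_eqI)
  fix v
  let ?at = "\<lambda>R. {e \<in> R. (h e = v) \<noteq> (k e = v)}"
  have "?at (sym_diff P Q) = sym_diff (?at P) (?at Q)" by blast
  moreover have "finite (?at P)" "finite (?at Q)" using assms by auto
  ultimately have "odd (card (?at (sym_diff P Q))) \<longleftrightarrow> odd (card (?at P)) \<noteq> odd (card (?at Q))"
    by (simp only: odd_card_sym_diff)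
  then show "v \<in> boundary h k (sym_diff P Q) \<longleftrightarrow> v \<in> sym_diff (boundary h k P) (boundary h k Q)"
    unfolding boundary_def by blast
qed

lemma boundary_empty [simp]: "boundary h k {} = {}"
  by (simp add: boundary_def)

lemma boundary_singleton: "boundary h k {e} = sym_diff {h e} {k e}"
proof (rule set_eqI)
  fix v
  have "{e' \<in> {e}. (h e' = v) \<noteq> (k e' = v)} = (if (h e = v) \<noteq> (k e = v) then {e} else {})"
    by (cases "h e = v"; cases "k e = v"; auto)
  then have "v \<in> boundary h k {e} \<longleftrightarrow> (h e = v) \<noteq> (k e = v)"
    unfolding boundary_def by simp
  then show "v \<in> boundary h k {e} \<longleftrightarrow> v \<in> sym_diff {h e} {k e}"
    by (cases "h e = v"; cases "k e = v"; simp)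
qed

lemma boundary_Diff:
  assumes "finite P" "Q \<subseteq> P"
  shows "boundary h k (P - Q) = sym_diff (boundary h k P) (boundary h k Q)"
proof -
  have "sym_diff P Q = P - Q" using assms by auto
  then show ?thesis using boundary_sym_diff[of P Q h k] assms finite_subset by metis
qed

section \<open>Idealness of the clutter of joins\<close>

text \<open>
  Walk from \<open>s\<close> along edges of \<open>P\<close>, deleting each edge used, until the walk enters \<open>U\<close> for the first
  time; the boundary of the rest of \<open>P\<close> moves along with the walk. The entry point \<open>b'\<close> need not be
  \<open>b\<close>.
\<close>

lemma path_crossing_cut_once:
  assumes "finite P" "boundary h k P = sym_diff {s} {b}" "s \<notin> U" "b \<in> U"
  shows "\<exists>P'\<subseteq>P. \<exists>b'\<in>U. boundary h k P' = sym_diff {s} {b'} \<and> card (edge_cut h k P' U) = 1"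
  using assms
proof (induction P arbitrary: s rule: finite_psubset_induct)
  case (psubset P)
  have "s \<in> boundary h k P" using psubset.prems by auto
  then have "odd (card {e \<in> P. (h e = s) \<noteq> (k e = s)})"
    by (simp add: boundary_def)
  then have "{e \<in> P. (h e = s) \<noteq> (k e = s)} \<noteq> {}"
    by (metis card.empty even_zero)
  then obtain e where e: "e \<in> P" "(h e = s) \<noteq> (k e = s)" by blast
  define v where "v = (if h e = s then k e else h e)"
  have v: "h e = s \<and> k e = v \<or> h e = v \<and> k e = s" "v \<noteq> s" using e by (auto simp: v_def)
  have bd_e: "boundary h k {e} = sym_diff {s} {v}"
    using v by (auto simp: boundary_singleton)
  show ?case
  proof (cases "v \<in> U")
    case True
    then have "edge_cut h k {e} U = {e}"
      using v psubset.prems by (auto simp: edge_cut_def)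
    then show ?thesis using True bd_e e by (intro exI[of _ "{e}"]) auto
  next
    case False
    have "boundary h k (P - {e}) = sym_diff {v} {b}"
      using bd_e psubset.prems psubset.hyps e v False by (subst boundary_Diff) auto
    then obtain P' b' where P': "P' \<subseteq> P - {e}" "b' \<in> U" "boundary h k P' = sym_diff {v} {b'}"
        "card (edge_cut h k P' U) = 1"
      using psubset.IH[OF _ _ False \<open>b \<in> U\<close>, of "P - {e}"] e by blast
    have fin: "finite P'" using P' psubset.hyps by (meson finite_Diff finite_subset)
    have "insert e P' = sym_diff P' {e}" using P' by auto
    then have "boundary h k (insert e P') = sym_diff {s} {b'}"
      using P' bd_e boundary_sym_diff[of P' "{e}" h k] fin psubset.prems False v by auto
    moreover have "edge_cut h k (insert e P') U = edge_cut h k P' U"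
      using v False psubset.prems by (auto simp: edge_cut_def)
    moreover have "insert e P' \<subseteq> P" using P' e by blast
    ultimately show ?thesis using P'(2,4) by metis
  qed
qed

lemma sum_sym_diff_null:
  fixes x :: "'a \<Rightarrow> real"
  assumes "finite Q" "finite Z" "\<And>e. e \<in> Z \<Longrightarrow> x e = 0"
  shows "sum x (sym_diff Q Z) = sum x Q"
  using assms by (intro sum.mono_neutral_cong) auto

text \<open>
  Let \<open>x\<close> be nonnegative edge lengths. Fix an end \<open>s\<close> of an edge of positive length in a shortest
  \<open>T\<close>-join, and choose a vertex \<open>b\<close> and a join \<open>Q\<close> for \<open>T + s + b\<close> such that the length of \<open>Q\<close> is
  least over all choices of \<open>b\<close>. It is less than the length of a shortest \<open>T\<close>-join. The cut is the
  boundary of the set \<open>U\<close> of vertices at distance 0 from \<open>b\<close>, so all its edges are positive.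

  The choice of \<open>b\<close> forces every optimal \<open>R\<close> that leads to a vertex of \<open>U\<close> to avoid the cut:
  deleting a cut edge from \<open>R\<close> (after a shift inside \<open>U\<close> of length 0) would lead to a vertex
  outside \<open>U\<close> with smaller length. If \<open>F\<close> is any \<open>T\<close>-join, then \<open>F + Q\<close> joins \<open>s\<close> to \<open>b\<close> and so
  crosses the cut, and it does so in edges of \<open>F\<close>. If \<open>F\<close> is shortest, split \<open>F + Q\<close> into a path
  \<open>P'\<close> that crosses the cut once and a remainder \<open>P''\<close>, which is closed up to length 0. Shortness of
  \<open>F\<close> implies that \<open>F + P'\<close> is not longer than \<open>Q = F + P' + P''\<close>. So it is optimal and avoids the
  cut, whence \<open>F\<close> and \<open>P'\<close> agree on the cut.
\<close>

lemma tight_T_cut: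
  fixes x :: "'e \<Rightarrow> real"
  assumes fin: "finite E" and nonneg: "\<And>e. e \<in> E \<Longrightarrow> 0 \<le> x e"
    and F0: "F0 \<in> joins h k E T" and F0_pos: "0 < sum x F0"
    and F0_min: "\<And>F. F \<in> joins h k E T \<Longrightarrow> sum x F0 \<le> sum x F"
  shows "\<exists>U. (\<forall>e\<in>edge_cut h k E U. 0 < x e) \<and>
    (\<forall>F\<in>joins h k E T. F \<inter> edge_cut h k E U \<noteq> {} \<and>
       (sum x F = sum x F0 \<longrightarrow> card (F \<inter> edge_cut h k E U) = 1))"
proof -
  note finE = finite_subset[OF _ fin]
  let ?bd = "boundary h k"
  obtain e0 where e0: "e0 \<in> F0" "0 < x e0"
    by (meson F0_pos linorder_not_le sum_nonpos)
  define s where "s = h e0"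
  define cand where "cand = {Q. Q \<subseteq> E \<and> (\<exists>v. ?bd Q = sym_diff T (sym_diff {s} {v}))}"
  have F0E: "F0 \<subseteq> E" and bdF0: "?bd F0 = T" using F0 by (auto simp: joins_def)
  have "F0 - {e0} \<in> cand"
  proof -
    have "?bd (F0 - {e0}) = sym_diff T (sym_diff {s} {k e0})"
      using e0 finE[OF F0E] by (simp add: boundary_Diff boundary_singleton bdF0 s_def)
    then show ?thesis using F0E by (auto simp: cand_def)
  qed
  moreover have "finite cand" using fin by (simp add: cand_def)
  ultimately obtain Q where Q: "Q \<in> cand" and Q_min: "\<And>R. R \<in> cand \<Longrightarrow> sum x Q \<le> sum x R"
    using arg_min_if_finite(1)[of cand "sum x"] arg_min_least[of cand _ "sum x"] by (metis empty_iff)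
  then obtain b where QE: "Q \<subseteq> E" and bdQ: "?bd Q = sym_diff T (sym_diff {s} {b})"
    by (auto simp: cand_def)
  have Q_less: "sum x Q < sum x F0"
  proof -
    have "sum x Q \<le> sum x (F0 - {e0})" using \<open>F0 - {e0} \<in> cand\<close> by (rule Q_min)
    also have "\<dots> < sum x F0" using e0 finE[OF F0E] by (simp add: sum_diff1)
    finally show ?thesis .
  qed
  define U where "U = {v. \<exists>Z\<subseteq>E. (\<forall>e\<in>Z. x e = 0) \<and> ?bd Z = sym_diff {b} {v}}"
  define B where "B = edge_cut h k E U"
  have null: "\<exists>Z\<subseteq>E. (\<forall>e\<in>Z. x e = 0) \<and> ?bd Z = sym_diff {u} {v}" if "u \<in> U" "v \<in> U" for u v
  proof -
    obtain Y where Y: "Y \<subseteq> E" "\<forall>e\<in>Y. x e = 0" "?bd Y = sym_diff {b} {u}"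
      using \<open>u \<in> U\<close> by (auto simp: U_def)
    obtain Z where Z: "Z \<subseteq> E" "\<forall>e\<in>Z. x e = 0" "?bd Z = sym_diff {b} {v}"
      using \<open>v \<in> U\<close> by (auto simp: U_def)
    show ?thesis
      using Y Z by (intro exI[of _ "sym_diff Y Z"]) (auto simp: boundary_sym_diff finE)
  qed
  have bU: "b \<in> U"
    unfolding U_def mem_Collect_eq by (rule exI[of _ "{}"]) simp
  \<comment> \<open>Otherwise \<open>Q\<close> could be led back to \<open>s\<close> at no cost, giving a \<open>T\<close>-join shorter than \<open>F0\<close>.\<close>
  have sU: "s \<notin> U"
  proof
    assume "s \<in> U"
    then obtain Z where Z: "Z \<subseteq> E" "\<forall>e\<in>Z. x e = 0" "?bd Z = sym_diff {b} {s}"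
      by (auto simp: U_def)
    have "sym_diff Q Z \<in> joins h k E T"
      using QE Z bdQ by (auto simp: joins_def boundary_sym_diff finE)
    then have "sum x F0 \<le> sum x (sym_diff Q Z)" by (rule F0_min)
    also have "\<dots> = sum x Q" using QE Z by (intro sum_sym_diff_null) (auto simp: finE)
    finally show False using Q_less by simp
  qed
  have B_ends: "\<exists>u v. u \<in> U \<and> v \<notin> U \<and> ?bd {e} = sym_diff {u} {v}" if "e \<in> B" for e
    using that unfolding B_def edge_cut_def boundary_singleton by blast
  have B_pos: "0 < x e" if e: "e \<in> B" for e
  proof (rule ccontr)
    assume "\<not> 0 < x e"
    then have "x e = 0" using nonneg[of e] e by (auto simp: B_def edge_cut_def)
    obtain u v where uv: "u \<in> U" "v \<notin> U" "?bd {e} = sym_diff {u} {v}"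
      using B_ends[OF e] by blast
    obtain Z where Z: "Z \<subseteq> E" "\<forall>e\<in>Z. x e = 0" "?bd Z = sym_diff {b} {u}"
      using uv by (auto simp: U_def)
    have "v \<in> U"
      unfolding U_def
      using Z uv e \<open>x e = 0\<close>
      by (auto simp: boundary_sym_diff finE B_def edge_cut_def intro!: exI[of _ "sym_diff Z {e}"])
    then show False using uv by simp
  qed
  have opt_disjoint: "R \<inter> B = {}"
    if R: "R \<subseteq> E" "?bd R = sym_diff T (sym_diff {s} {c})" "c \<in> U" "sum x R \<le> sum x Q" for R c
  proof (rule ccontr)
    assume "R \<inter> B \<noteq> {}"
    then obtain e where e: "e \<in> R" "e \<in> B" by auto
    obtain u v where uv: "u \<in> U" "v \<notin> U" "?bd {e} = sym_diff {u} {v}"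
      using B_ends[OF e(2)] by blast
    obtain Z where Z: "Z \<subseteq> E" "\<forall>e\<in>Z. x e = 0" "?bd Z = sym_diff {c} {u}"
      using null[OF R(3) uv(1)] by blast
    define R' where "R' = sym_diff R Z"
    have R'E: "R' \<subseteq> E" using R Z by (auto simp: R'_def)
    have "e \<in> R'" using e Z B_pos[OF e(2)] by (auto simp: R'_def)
    have bdR': "?bd R' = sym_diff T (sym_diff {s} {u})"
      using R Z unfolding R'_def by (subst boundary_sym_diff) (auto simp: finE)
    have "?bd (R' - {e}) = sym_diff T (sym_diff {s} {v})"
      using uv bdR' \<open>e \<in> R'\<close> finE[OF R'E] by (subst boundary_Diff) auto
    then have "R' - {e} \<in> cand" using R'E unfolding cand_def by blast
    then have "sum x Q \<le> sum x (R' - {e})" by (rule Q_min)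
    also have "\<dots> = sum x R' - x e" using \<open>e \<in> R'\<close> finE[OF R'E] by (simp add: sum_diff1)
    also have "sum x R' = sum x R"
      unfolding R'_def using R Z by (intro sum_sym_diff_null) (auto simp: finE)
    finally show False using R(4) B_pos[OF e(2)] by simp
  qed
  have QB: "Q \<inter> B = {}" using opt_disjoint[OF QE bdQ bU] by simp
  have "F \<inter> B \<noteq> {} \<and> (sum x F = sum x F0 \<longrightarrow> card (F \<inter> B) = 1)" if F: "F \<in> joins h k E T" for F
  proof -
    have FE: "F \<subseteq> E" and bdF: "?bd F = T" using F by (auto simp: joins_def)
    define P where "P = sym_diff Q F"
    have PE: "P \<subseteq> E" using QE FE by (auto simp: P_def)
    have bdP: "?bd P = sym_diff {s} {b}"
      using bdF bdQ QE FE unfolding P_def by (subst boundary_sym_diff) (auto simp: finE)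
    have cut_P: "edge_cut h k P' U = F \<inter> P' \<inter> B" if "P' \<subseteq> P" for P'
      using that QB PE unfolding P_def B_def edge_cut_def by blast
    obtain P' b' where P': "P' \<subseteq> P" "b' \<in> U" "?bd P' = sym_diff {s} {b'}"
        "card (edge_cut h k P' U) = 1"
      using path_crossing_cut_once[OF finE[OF PE] bdP sU bU] by blast
    have "F \<inter> B \<noteq> {}"
    proof
      assume "F \<inter> B = {}"
      then have "edge_cut h k P' U = {}" using cut_P[OF P'(1)] by blast
      then show False using P'(4) by simp
    qed
    moreover have "card (F \<inter> B) = 1" if F_opt: "sum x F = sum x F0"
    proof -
      define P'' where "P'' = P - P'"
      define R where "R = sym_diff F P'"
      have RE: "R \<subseteq> E" using FE PE P' by (auto simp: R_def)
      have bdR: "?bd R = sym_diff T (sym_diff {s} {b'})"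
        using P' PE FE bdF unfolding R_def by (subst boundary_sym_diff) (auto intro: finE)
      obtain Z where Z: "Z \<subseteq> E" "\<forall>e\<in>Z. x e = 0" "?bd Z = sym_diff {b} {b'}"
        using null[OF bU P'(2)] by blast
      have bdP'': "?bd P'' = sym_diff {b} {b'}"
        unfolding P''_def using finE[OF PE] P' bdP sU bU by (subst boundary_Diff) auto
      have P''E: "P'' \<subseteq> E" using PE by (auto simp: P''_def)
      \<comment> \<open>Closing \<open>P''\<close> by null edges turns \<open>F + P''\<close> into a \<open>T\<close>-join without changing its length.\<close>
      have "sym_diff (sym_diff F P'') Z \<in> joins h k E T"
        using FE P''E Z bdF bdP'' by (auto simp: joins_def boundary_sym_diff finE)
      then have "sum x F \<le> sum x (sym_diff (sym_diff F P'') Z)" unfolding F_opt by (rule F0_min)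
      also have "\<dots> = sum x (sym_diff F P'')"
        using FE P''E Z by (intro sum_sym_diff_null) (auto simp: finE)
      finally have F_le: "sum x F \<le> sum x (sym_diff F P'')" .
      have sum_sd: "sum x (sym_diff A P'') = sum x A + (sum x (P'' - A) - sum x (A \<inter> P''))" if "A \<subseteq> E" for A
      proof -
        have "sum x (sym_diff A P'') = sum x (A - P'') + sum x (P'' - A)"
          using that P''E by (intro sum.union_disjoint) (auto simp: finE)
        moreover have "sum x A = sum x (A - P'') + sum x (A \<inter> P'')"
          by (metis finE that sum.Int_Diff add.commute)
        ultimately show ?thesis by simp
      qed
      have "Q = sym_diff R P''" using P' unfolding R_def P''_def P_def by blast
      moreover have "P'' - R = P'' - F" "R \<inter> P'' = F \<inter> P''"
        unfolding R_def P''_def by auto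
      ultimately have "sum x R \<le> sum x Q"
        using sum_sd[OF RE] sum_sd[OF FE] F_le by simp
      then have "R \<inter> B = {}" using opt_disjoint[OF RE bdR P'(2)] by simp
      then have "F \<inter> B = edge_cut h k P' U"
        using cut_P[OF P'(1)] unfolding R_def by blast
      then show ?thesis using P'(4) by simp
    qed
    ultimately show ?thesis by blast
  qed
  then show ?thesis using B_pos unfolding B_def by blast
qed

text \<open>
  For empty \<open>T\<close> the empty set is a join, so the covering polyhedron is empty and has no optimum.
  If no join is tight at \<open>x\<close>, the support of \<open>x\<close> serves as cover.
\<close>

theorem ideal_clutter_joins:
  fixes h k :: "'e \<Rightarrow> 'v"
  assumes fin: "finite E" and "T \<noteq> {}"
  shows "ideal_clutter E (joins h k E T)"
proof (rule ideal_clutter_if_tight_cover[OF fin])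
  show "joins h k E T \<subseteq> Pow E" "{} \<notin> joins h k E T"
    using \<open>T \<noteq> {}\<close> by (auto simp: joins_def)
  fix x assume "x \<in> covering_polyhedron E (joins h k E T)"
  then have x: "\<And>F. F \<in> joins h k E T \<Longrightarrow> 1 \<le> sum x F" "\<And>e. e \<in> E \<Longrightarrow> 0 \<le> x e"
    by (auto simp: covering_polyhedron_def)
  show "\<exists>B\<subseteq>E. (\<forall>e\<in>B. x e > 0) \<and> (\<forall>F\<in>joins h k E T. F \<inter> B \<noteq> {}) \<and>
            (\<forall>F\<in>joins h k E T. sum x F = 1 \<longrightarrow> card (F \<inter> B) = 1)"
  proof (cases "\<exists>F0\<in>joins h k E T. sum x F0 = 1")
    case True
    then obtain F0 where F0: "F0 \<in> joins h k E T" "sum x F0 = 1" by auto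
    have "\<exists>U. (\<forall>e\<in>edge_cut h k E U. 0 < x e) \<and>
    (\<forall>F\<in>joins h k E T. F \<inter> edge_cut h k E U \<noteq> {} \<and>
       (sum x F = sum x F0 \<longrightarrow> card (F \<inter> edge_cut h k E U) = 1))"
      using fin x F0 by (intro tight_T_cut) auto
    then obtain U where "\<forall>e\<in>edge_cut h k E U. 0 < x e"
      "\<forall>F\<in>joins h k E T. F \<inter> edge_cut h k E U \<noteq> {} \<and> (sum x F = 1 \<longrightarrow> card (F \<inter> edge_cut h k E U) = 1)"
      unfolding F0(2) by blast
    then show ?thesis
      by (intro exI[of _ "edge_cut h k E U"]) (auto simp: edge_cut_def)
  next
    case False
    have "F \<inter> {e \<in> E. 0 < x e} \<noteq> {}" if F: "F \<in> joins h k E T" for F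
    proof -
      have "\<not> sum x F \<le> 0" using x(1)[OF F] by simp
      then obtain e where "e \<in> F" "0 < x e" by (meson linorder_not_le sum_nonpos)
      then show ?thesis using F by (auto simp: joins_def)
    qed
    then show ?thesis using False by (intro exI[of _ "{e \<in> E. 0 < x e}"]) auto
  qed
qed

lemma binary_clutter_joins:
  assumes fin: "finite E"
  shows "binary_clutter (joins h k E T)"
proof -
  have *: "symm_diff_list As \<subseteq> E \<and> boundary h k (symm_diff_list As) = (if odd (length As) then T else {})"
    if "set As \<subseteq> joins h k E T" for As
    using that
  proof (induction As)
    case Nil
    then show ?case by (simp add: symm_diff_list_def)
  next
    case (Cons A As)
    then have "A \<subseteq> E" "symm_diff_list As \<subseteq> E" "boundary h k A = T" by (auto simp: joins_def)
    moreover have "symm_diff_list (A # As) = sym_diff A (symm_diff_list As)"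
      by (simp add: symm_diff_list_def)
    ultimately show ?case
      using Cons fin by (auto simp: boundary_sym_diff finite_subset[OF _ fin])
  qed
  then have "symm_diff_list As \<in> joins h k E T" if "set As \<subseteq> joins h k E T" "odd (length As)" for As
    using that by (simp add: joins_def)
  then show ?thesis unfolding binary_clutter_def by blast
qed

section \<open>The Petersen graph is not covered by two cycles\<close>

text \<open>Outer pentagon, spokes, inner pentagram.\<close>

definition petersen :: "(nat \<times> nat) list" where
  "petersen = [(0,1), (1,2), (2,3), (3,4), (4,0),
               (0,5), (1,6), (2,7), (3,8), (4,9),
               (5,7), (7,9), (9,6), (6,8), (8,5)]"

definition tail :: "nat \<Rightarrow> nat" where "tail i = fst (petersen ! i)"
definition head :: "nat \<Rightarrow> nat" where "head i = snd (petersen ! i)"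

lemma even_card_Int_insert:
  assumes "finite A" "a \<notin> A"
  shows "even (card (J \<inter> insert a A)) \<longleftrightarrow> (a \<in> J) \<noteq> even (card (J \<inter> A))"
  using assms by (cases "a \<in> J") (simp_all add: Int_insert_right)

lemma petersen_vertex_parity:
  assumes "P \<subseteq> {..<15}" "boundary tail head P = {}" 
    and star: "filter (\<lambda>i. (tail i = v) \<noteq> (head i = v)) [0..<15] = [a, b, c]"
  shows "a \<in> P \<longleftrightarrow> (b \<in> P \<longleftrightarrow> c \<notin> P)"
proof -
  have "{i \<in> P. (tail i = v) \<noteq> (head i = v)} =
      P \<inter> set (filter (\<lambda>i. (tail i = v) \<noteq> (head i = v)) [0..<15])"
    using assms(1) by auto
  then have "{i \<in> P. (tail i = v) \<noteq> (head i = v)} = P \<inter> {a, b, c}"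
    unfolding star by simp
  moreover have "v \<notin> boundary tail head P" using assms(2) by simp
  ultimately have "even (card (P \<inter> {a, b, c}))" by (simp add: boundary_def)
  moreover have "distinct [a, b, c]"
    unfolding star[symmetric] by simp
  ultimately show ?thesis by (simp add: even_card_Int_insert)
qed

text \<open>
  Colour an edge by its memberships in \<open>P\<close> and \<open>Q\<close>, a nonzero vector over the two-element field if
  \<open>P\<close> and \<open>Q\<close> cover. At each vertex the three colours sum to zero and are therefore distinct: a
  3-edge-colouring. The vertex conditions and the covering conditions are 35 propositional
  constraints on 30 variables, which are refuted mechanically.
\<close>

lemma petersen_no_two_cycles_cover:
  assumes P: "P \<subseteq> {..<15}" "boundary tail head P = {}"
    and Q: "Q \<subseteq> {..<15}" "boundary tail head Q = {}"
  shows "P \<union> Q \<noteq> {..<15}"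
proof
  assume cover: "P \<union> Q = {..<15}"
  have stars:
    "filter (\<lambda>i. (tail i = 0) \<noteq> (head i = 0)) [0..<15] = [0, 4, 5]"
    "filter (\<lambda>i. (tail i = 1) \<noteq> (head i = 1)) [0..<15] = [0, 1, 6]"
    "filter (\<lambda>i. (tail i = 2) \<noteq> (head i = 2)) [0..<15] = [1, 2, 7]"
    "filter (\<lambda>i. (tail i = 3) \<noteq> (head i = 3)) [0..<15] = [2, 3, 8]"
    "filter (\<lambda>i. (tail i = 4) \<noteq> (head i = 4)) [0..<15] = [3, 4, 9]"
    "filter (\<lambda>i. (tail i = 5) \<noteq> (head i = 5)) [0..<15] = [5, 10, 14]"
    "filter (\<lambda>i. (tail i = 6) \<noteq> (head i = 6)) [0..<15] = [6, 12, 13]"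
    "filter (\<lambda>i. (tail i = 7) \<noteq> (head i = 7)) [0..<15] = [7, 10, 11]"
    "filter (\<lambda>i. (tail i = 8) \<noteq> (head i = 8)) [0..<15] = [8, 13, 14]"
    "filter (\<lambda>i. (tail i = 9) \<noteq> (head i = 9)) [0..<15] = [9, 11, 12]"
    by code_simp+
  note parity = stars[THEN petersen_vertex_parity[OF P]] stars[THEN petersen_vertex_parity[OF Q]]
  have mem: "i \<in> P \<or> i \<in> Q" if "i < 15" for i using cover that by blast
  have "0 \<in> P \<or> 0 \<in> Q" "1 \<in> P \<or> 1 \<in> Q" "2 \<in> P \<or> 2 \<in> Q" "3 \<in> P \<or> 3 \<in> Q" "4 \<in> P \<or> 4 \<in> Q"
    "5 \<in> P \<or> 5 \<in> Q" "6 \<in> P \<or> 6 \<in> Q" "7 \<in> P \<or> 7 \<in> Q" "8 \<in> P \<or> 8 \<in> Q" "9 \<in> P \<or> 9 \<in> Q"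
    "10 \<in> P \<or> 10 \<in> Q" "11 \<in> P \<or> 11 \<in> Q" "12 \<in> P \<or> 12 \<in> Q" "13 \<in> P \<or> 13 \<in> Q" "14 \<in> P \<or> 14 \<in> Q"
    by (rule mem; simp)+
  with parity show False by sat
qed

section \<open>The subdivided Petersen graph\<close>

text \<open>
  The halves of edge \<open>i\<close> are \<open>2 * i\<close>, at the tail, and \<open>2 * i + 1\<close>, at the head. They meet in the
  new vertex \<open>10 + i\<close>. As a join needs \<open>T\<close> of even size, one of the 25 vertices is left out of \<open>T\<close>.
\<close>

definition old_end :: "nat \<Rightarrow> nat" where
  "old_end e = (if even e then tail else head) (e div 2)"

definition new_end :: "nat \<Rightarrow> nat" where
  "new_end e = 10 + e div 2"

definition T30 :: "nat set set" where
  "T30 = joins old_end new_end {..<30} {1..<25}"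

lemma boundary_subdivision:
  assumes "finite P"
  shows "boundary old_end new_end ((\<lambda>i. 2 * i) ` P \<union> (\<lambda>i. 2 * i + 1) ` P) = boundary tail head P"
  using assms
proof (induction P)
  case empty
  then show ?case by simp
next
  case (insert i P)
  let ?D = "(\<lambda>i. 2 * i) ` P \<union> (\<lambda>i. 2 * i + 1) ` P"
  have "e \<noteq> 2 * i" "e \<noteq> 2 * i + 1" if "e \<in> ?D" for e
    using that insert.hyps by (auto, presburger+)
  then have D: "(\<lambda>i. 2 * i) ` insert i P \<union> (\<lambda>i. 2 * i + 1) ` insert i P =
      sym_diff (sym_diff {2 * i} {2 * i + 1}) ?D"
    by auto
  have P: "insert i P = sym_diff {i} P" using insert.hyps by auto
  have "boundary old_end new_end (sym_diff {2 * i} {2 * i + 1}) =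
      sym_diff (sym_diff {tail i} {10 + i}) (sym_diff {head i} {10 + i})"
    by (subst boundary_sym_diff) (simp_all add: boundary_singleton old_end_def new_end_def)
  also have "\<dots> = boundary tail head {i}"
    unfolding boundary_singleton by blast
  finally have "boundary old_end new_end (sym_diff (sym_diff {2 * i} {2 * i + 1}) ?D) =
      boundary tail head (sym_diff {i} P)"
    using insert.IH insert.hyps(1) by (simp only: boundary_sym_diff finite.intros finite_UnI
      finite_imageI finite_Diff)
  then show ?case unfolding D P[symmetric] .
qed

lemma T30_one_half:
  assumes J: "J \<in> T30" and i: "i < 15"
  shows "2 * i \<in> J \<longleftrightarrow> 2 * i + 1 \<notin> J"
proof -
  have "J \<subseteq> {..<30}" and bd: "boundary old_end new_end J = {1..<25}"
    using J by (auto simp: T30_def joins_def)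
  have "\<forall>e\<in>set [0..<30]. old_end e < 10" by code_simp
  then have "old_end e \<noteq> 10 + i" if "e \<in> J" for e
    using that \<open>J \<subseteq> {..<30}\<close> by force
  moreover have "new_end e = 10 + i \<longleftrightarrow> e = 2 * i \<or> e = 2 * i + 1" for e
    unfolding new_end_def by presburger
  ultimately have "{e \<in> J. (old_end e = 10 + i) \<noteq> (new_end e = 10 + i)} = J \<inter> {2 * i, 2 * i + 1}"
    by blast
  moreover have "10 + i \<in> boundary old_end new_end J" unfolding bd using i by simp
  ultimately have "odd (card (J \<inter> {2 * i, 2 * i + 1}))" by (simp add: boundary_def)
  then show ?thesis by (simp add: even_card_Int_insert)
qed

text \<open>
  The edges of the Petersen graph of which \<open>A\<close> and \<open>B\<close> choose different halves. Only tail halves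
  need to be compared, by \<open>T30_one_half\<close>.
\<close>

definition cycle_between :: "nat set \<Rightarrow> nat set \<Rightarrow> nat set" where
  "cycle_between A B = {i. i < 15 \<and> (2 * i \<in> A) \<noteq> (2 * i \<in> B)}"

lemma boundary_cycle_between:
  assumes A: "A \<in> T30" and B: "B \<in> T30"
  shows "boundary tail head (cycle_between A B) = {}"
proof -
  let ?P = "cycle_between A B"
  have AB: "A \<subseteq> {..<30}" "B \<subseteq> {..<30}" using A B by (auto simp: T30_def joins_def)
  have "e \<in> sym_diff A B \<longleftrightarrow> e \<in> (\<lambda>i. 2 * i) ` ?P \<union> (\<lambda>i. 2 * i + 1) ` ?P" for e
  proof (cases "e < 30")
    case True
    then have "\<exists>i<15. e = 2 * i \<or> e = 2 * i + 1" by presburger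
    then obtain i where "i < 15" "e = 2 * i \<or> e = 2 * i + 1" by blast
    then show ?thesis
      using T30_one_half[OF A] T30_one_half[OF B] by (auto simp: cycle_between_def)
  next
    case False
    then show ?thesis using AB by (auto simp: cycle_between_def)
  qed
  then have "sym_diff A B = (\<lambda>i. 2 * i) ` ?P \<union> (\<lambda>i. 2 * i + 1) ` ?P" by blast
  moreover have "finite ?P" by (simp add: cycle_between_def)
  ultimately have "boundary tail head ?P = boundary old_end new_end (sym_diff A B)"
    by (simp only: boundary_subdivision)
  also have "\<dots> = {}"
    using A B AB by (auto simp: boundary_sym_diff finite_subset T30_def joins_def)
  finally show ?thesis .
qed

lemma T30_three_members_meet:
  assumes A: "A \<in> T30" and B: "B \<in> T30" and C: "C \<in> T30"
  shows "\<exists>e<30. e \<in> A \<and> e \<in> B \<and> e \<in> C"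
proof -
  have "cycle_between A B \<union> cycle_between A C \<noteq> {..<15}"
    using A B C by (intro petersen_no_two_cycles_cover boundary_cycle_between)
      (auto simp: cycle_between_def)
  moreover have "cycle_between A B \<union> cycle_between A C \<subseteq> {..<15}"
    by (auto simp: cycle_between_def)
  ultimately obtain i where i: "i < 15" "i \<notin> cycle_between A B" "i \<notin> cycle_between A C" 
    by blast
  show ?thesis
  proof (cases "2 * i \<in> A")
    case True
    then show ?thesis using i by (intro exI[of _ "2 * i"]) (auto simp: cycle_between_def)
  next
    case False
    then show ?thesis using i T30_one_half[OF A] T30_one_half[OF B] T30_one_half[OF C]
      by (intro exI[of _ "2 * i + 1"]) (auto simp: cycle_between_def)
  qed
qed

lemma clutter_T30: "clutter {..<30} T30"
proof -
  have sub: "J \<subseteq> {..<30}" if "J \<in> T30" for J using that by (auto simp: T30_def joins_def)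
  have "B \<subseteq> A" if A: "A \<in> T30" and B: "B \<in> T30" and "A \<subseteq> B" for A B
  proof
    fix e assume "e \<in> B"
    then have "e < 30" using sub[OF B] by auto
    then have "\<exists>i<15. e = 2 * i \<or> e = 2 * i + 1" by presburger
    then obtain i where i: "i < 15" "e = 2 * i \<or> e = 2 * i + 1" by blast
    show "e \<in> A"
      using T30_one_half[OF A i(1)] T30_one_half[OF B i(1)] i(2) \<open>e \<in> B\<close> \<open>A \<subseteq> B\<close> by auto
  qed
  then show ?thesis using sub by (auto simp: clutter_def)
qed

text \<open>
  The vertices of odd degree in a list of edges given by their ends, for use with the simplifier as
  evaluator: it evaluates the argument of a constant once, but a subterm of an abstraction again at
  each use.
\<close>

definition odd_vertices :: "nat \<Rightarrow> (nat \<times> nat) list \<Rightarrow> nat list" where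
  "odd_vertices n ends = filter (\<lambda>v. odd (length (filter (\<lambda>(a, b). (a = v) \<noteq> (b = v)) ends))) [0..<n]"

lemma boundary_eq_odd_vertices:
  assumes es: "distinct es" "\<And>e. e \<in> set es \<Longrightarrow> h e < n \<and> k e < n"
  shows "boundary h k (set es) = set (odd_vertices n (map (\<lambda>e. (h e, k e)) es))"
proof -
  have mem: "v \<in> boundary h k (set es) \<longleftrightarrow>
      odd (length (filter (\<lambda>e. (h e = v) \<noteq> (k e = v)) es))" for v
    using es distinct_card[of "filter (\<lambda>e. (h e = v) \<noteq> (k e = v)) es"]
    by (simp add: boundary_def)
  have "v < n" if "v \<in> boundary h k (set es)" for v
  proof (rule ccontr)
    assume "\<not> v < n"
    then have "filter (\<lambda>e. (h e = v) \<noteq> (k e = v)) es = []"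
      using es(2) by (auto simp: filter_empty_conv)
    then show False using that unfolding mem by simp
  qed
  then show ?thesis
    by (auto simp: odd_vertices_def mem filter_map o_def)
qed

text \<open>
  The cycles from the first member to the other three cover the Petersen graph.
\<close>

lemma T30_no_common_element:
  "\<exists>A\<in>T30. \<exists>B\<in>T30. \<exists>C\<in>T30. \<exists>D\<in>T30. A \<inter> B \<inter> C \<inter> D = {}"
proof -
  have member: "set es \<in> T30"
    if "distinct es \<and> (\<forall>e\<in>set es. e < 30 \<and> old_end e < 25 \<and> new_end e < 25)"
      and "odd_vertices 25 (map (\<lambda>e. (old_end e, new_end e)) es) = [1..<25]" for es
    using that boundary_eq_odd_vertices[of es old_end 25 new_end]
    by (auto simp: T30_def joins_def)
  have "set [1, 2, 5, 6, 9, 10, 12, 14, 16, 18, 21, 23, 25, 27, 29] \<in> T30"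
    by (rule member; code_simp)
  moreover have "set [0, 3, 4, 7, 8, 10, 12, 14, 16, 18, 21, 23, 25, 27, 29] \<in> T30"
    by (rule member; code_simp)
  moreover have "set [0, 2, 5, 7, 9, 11, 13, 14, 17, 19, 20, 22, 25, 26, 29] \<in> T30"
    by (rule member; code_simp)
  moreover have "set [1, 3, 5, 7, 9, 10, 13, 15, 17, 19, 20, 23, 24, 27, 28] \<in> T30"
    by (rule member; code_simp)
  moreover have "set [1, 2, 5, 6, 9, 10, 12, 14, 16, 18, 21, 23, 25, 27, 29] \<inter>
      set [0, 3, 4, 7, 8, 10, 12, 14, 16, 18, 21, 23, 25, 27, 29] \<inter>
      set [0, 2, 5, 7, 9, 11, 13, 14, 17, 19, 20, 22, 25, 26, 29] \<inter>
      set [1, 3, 5, 7, 9, 10, 13, 15, 17, 19, 20, 23, 24, 27, 28 :: nat] = {}"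
    by code_simp
  ultimately show ?thesis by blast
qed

lemma k_wise_intersecting_T30: "k_wise_intersecting 3 {..<30} T30"
proof -
  have "\<exists>e\<in>{..<30}. \<forall>A\<in>S. e \<in> A" if S: "S \<subseteq> T30" "finite S" "card S \<le> 3" for S
  proof (cases "S = {}")
    case True
    then show ?thesis by (auto intro: exI[of _ 0])
  next
    case False
    then have "card S = 1 \<or> card S = 2 \<or> card S = 3"
      using S by (auto simp: le_Suc_eq numeral_3_eq_3 numeral_2_eq_2)
    then obtain A B C where "S = {A, B, C}"
      by (metis card_1_singleton_iff card_2_iff card_3_iff insert_absorb2 One_nat_def)
    then show ?thesis using T30_three_members_meet[of A B C] S by auto
  qed
  moreover have "\<not> (\<exists>e\<in>{..<30}. \<forall>A\<in>T30. e \<in> A)"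
    using T30_no_common_element by blast
  ultimately show ?thesis unfolding k_wise_intersecting_def by blast
qed

theorem proposition5:
  "\<exists>(V :: nat set) (C :: nat set set).
     clutter V C \<and> ideal_clutter V C \<and> k_wise_intersecting 3 V C \<and> binary_clutter C"
proof -
  have "ideal_clutter {..<30} T30"
    unfolding T30_def by (rule ideal_clutter_joins) (simp_all add: atLeastLessThan_empty_iff)
  moreover have "binary_clutter T30"
    unfolding T30_def by (rule binary_clutter_joins) simp
  ultimately show ?thesis
    using clutter_T30 k_wise_intersecting_T30 by blast
qed

end
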